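(* Let $\mathcal{H}$ be a real Hilbert space, $(\Theta_n:\mathcal{H}\to[0,\infty))_{n\in\mathbb{N}}$ a sequence of convex continuous (not necessarily differentiable) functions, and $(T_n:\mathcal{H}\to\mathcal{H})_{n\in\mathbb{N}}$ a sequence of mappings with nonempty fixed point sets such that $T_n$ is $\eta_n$-attracting quasi-nonexpansive, $\eta_n>0$, for every $n$. Let $\lambda_n\in(0,2)$ for all $n$, let $u_0\in\mathcal{H}$ be arbitrary, and let $(u_n)_{n\in\mathbb{N}}$ be generated by $$u_{n+1}:=\begin{cases}T_n\Big(u_n-\lambda_n\frac{\Theta_n(u_n)}{\|\Theta_n'(u_n)\|^2}\Theta_n'(u_n)\Big), & \text{if }\Theta_n'(u_n)\neq0,\\ T_n(u_n), & \text{if }\Theta_n'(u_n)=0,\end{cases}$$ where $\Theta_n'(u_n)$ is any subgradient of $\Theta_n$ at $u_n$. Consider the following assumptions, where $\Omega_n:=\mathrm{Fix}(T_n)\cap\mathrm{lev}_{\le0}\Theta_n$. (A1) There is $N\subset\mathbb{N}$ with $\mathbb{N}\setminus N$ finite such that $\Omega_n\neq\emptyset$ for all $n\in N$. (A2) There is $N\subset\mathbb{N}$ with $\mathbb{N}\setminus N$ finite such that $\Omega:=\bigcap_{n\in N}\Omega_n\neq\emptyset$. (A3) There is $\epsilon\in(0,1]$ such that $\lambda_n\in[\epsilon,2-\epsilon]$ for all $n\in\mathbb{N}$. (A4) The sequence $(\Theta_n'(u_n))_{n\in\mathbb{N}}$ is bounded. (A5) $\check\eta:=\inf_{n}\eta_n>0$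 and $\hat\eta:=\sup_n\eta_n<\infty$. (A6) The sequence of relaxed subgradient projection mappings $(T_{\Theta_n}^{(\lambda_n)})_{n}$ satisfies condition (L) of the context. (A7) The sequence $(T_n)_{n\in\mathbb{N}}$ satisfies condition (L) of the context. (A8) $T_n=T$ for all $n\in\mathbb{N}$, where $T$ is a strongly attracting quasi-nonexpansive mapping with $\mathrm{Fix}(T)\neq\emptyset$ and $I-T$ is demiclosed at $0$. (A9) The set $\mathfrak{S}((u_n)_{n\in\mathbb{N}})$ of all strong cluster points of $(u_n)$ is nonempty. (A10) There is a hyperplane $\Pi\subset\mathcal{H}$ such that $\mathrm{ri}_\Pi(\Omega)\neq\emptyset$, with $\Omega$ as in (A2). Then: 1. If (A1) holds, then $d(u_{n+1},\Omega_n)\le d(u_n,\Omega_n)$ for all $n\in N$ ($N$ as in (A1)). 2. If (A2) holds, then $d(u_{n+1},\Omega)\le d(u_n,\Omega)$ for all $n\in N$ ($N$ as in (A2)). 3. If (A2) holds, then for every $v\in\Omega$ the sequence $(\|u_n-v\|)_{n\in\mathbb{N}}$ converges. 4. If (A2) holds, then the set $\mathfrak{W}((u_n)_{n\in\mathbb{N}})$ of all weak sequential cluster points of $(u_n)$ is nonempty. 5. If (A2) and (A3) hold, then $\lim_{n\to\infty}\|(I-T_{\Theta_n}^{(\lambda_n)})(u_n)\|=\lim_{n\to\infty}\frac{\Theta_n(u_n)}{\|\Theta_n'(u_n)\|}=0$, with the convention $\frac00:=0$. 6. If (A2), (A3) and (A4) hold, then $\lim_{n\to\infty}\Theta_n(u_n)=0$.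 7. If (A2), (A3), (A6) and (A9) hold, then $\mathfrak{S}((u_n)_{n\in\mathbb{N}})\subset\limsup_{n\to\infty}\mathrm{lev}_{\le0}\Theta_n$. If, in addition, the set $\mathfrak{S}((u_n)_{n\in\mathbb{N}})$ is a singleton, i.e., there exists $u_*$ such that $\mathfrak{S}((u_n)_{n\in\mathbb{N}})=\{u_*\}$, then $u_*\in\liminf_{n\to\infty}\mathrm{lev}_{\le0}\Theta_n$. 8. If (A2) and (A5) hold, then $\lim_{n\to\infty}(I-T_n)(T_{\Theta_n}^{(\lambda_n)}(u_n))=0$. 9. If (A2), (A3), (A5), (A7) and (A9) hold, then $\mathfrak{S}((u_n)_{n\in\mathbb{N}})\subset\limsup_{n\to\infty}\mathrm{Fix}(T_n)$. If, in addition, the set $\mathfrak{S}((u_n)_{n\in\mathbb{N}})$ is a singleton, i.e., there exists $u_*$ such that $\mathfrak{S}((u_n)_{n\in\mathbb{N}})=\{u_*\}$, then $u_*\in\liminf_{n\to\infty}\mathrm{Fix}(T_n)$. 10. If (A2), (A3) and (A8) hold, then $\mathfrak{W}((u_n)_{n\in\mathbb{N}})\subset\mathrm{Fix}(T)$. 11. If (A2), (A3), (A8) and (A9) hold, then $\mathfrak{S}((u_n)_{n\in\mathbb{N}})\subset\mathrm{Fix}(T)$. 12. If (A2), (A3), (A5) and (A10) hold, then there is $u_*\in\mathcal{H}$ with $\lim_{n\to\infty}u_n=u_*$ (strongly), i.e. $\mathfrak{S}((u_n)_{n\in\mathbb{N}})=\{u_*\}$.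
   Context: Unless said otherwise limits are in norm. $I$ is the identity, $d(x,S)=\inf_{v\in S}\|x-v\|$, $\mathrm{Fix}(T)=\{v:T(v)=v\}$, $\mathrm{lev}_{\le0}\Theta=\{v\in\mathcal{H}:\Theta(v)\le0\}$. A mapping $T$ with $\mathrm{Fix}(T)\ne\emptyset$ is quasi-nonexpansive if $\|T(x)-v\|\le\|x-v\|$ for all $x\in\mathcal{H}$, $v\in\mathrm{Fix}(T)$; it is $\eta$-attracting quasi-nonexpansive ($\eta>0$) if $\eta\|x-T(x)\|^2\le\|x-v\|^2-\|T(x)-v\|^2$ for all $x\in\mathcal{H}$, $v\in\mathrm{Fix}(T)$; it is strongly attracting if it is $\eta$-attracting for some $\eta>0$. The subdifferential is $\partial\Theta(x)=\{v:\langle v,y-x\rangle+\Theta(x)\le\Theta(y)\ \forall y\in\mathcal{H}\}$; it is nonempty for convex continuous $\Theta$, and $\Theta'(x)$ denotes an element (subgradient) of it. For each $n$ a choice $x\mapsto\Theta_n'(x)\in\partial\Theta_n(x)$ is fixed and used everywhere. For convex continuous $\Theta$ with $\mathrm{lev}_{\le0}\Theta\ne\emptyset$ and $\lambda\in(0,2)$, the relaxed subgradient projection mapping is $T_\Theta^{(\lambda)}:=I+\lambda(T_\Theta-I)$, where $T_\Theta(x)=x-\frac{\Theta(x)}{\|\Theta'(x)\|^2}\Theta'(x)$ if $\Theta(x)>0$ and $T_\Theta(x)=x$ if $\Theta(x)\le0$; its fixed point set is $\mathrm{lev}_{\le0}\Theta$. Under (A2), $T_{\Theta_n}^{(\lambda_n)}$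 is defined for all $n\in N$, i.e. for all but finitely many $n$, and statements about it refer to these $n$. Condition (L) for a sequence of mappings $(R_n)_n$ with nonempty fixed point sets: for every infinite index set $M\subset\mathbb{N}$, every $(x_n)_{n\in M}\subset\mathcal{H}$ and every $\gamma>0$ with $d(x_n,\mathrm{Fix}(R_n))\ge\gamma$ for all $n\in M$, there is $\delta>0$ with $\liminf_{n\in M}\|(I-R_n)(x_n)\|\ge\delta$. A mapping $R:\mathcal{H}\to\mathcal{H}$ is demiclosed at $0$ if $x_n\rightharpoonup x_*$ weakly and $R(x_n)\to0$ strongly imply $R(x_* )=0$. For $S,\Upsilon\subset\mathcal{H}$, $\mathrm{ri}_\Upsilon S:=\{v\in S:\exists\rho>0,\ \emptyset\ne(B(v,\rho)\cap\Upsilon)\subset S\}$, where $B(v,\rho)$ is the open ball. A hyperplane is a closed affine subspace of codimension one. For subsets $S_n$ of $\mathcal{H}$: $\liminf_{n\to\infty}S_n$ is the set of $x$ for which there exist $N\subset\mathbb{N}$ with finite complement and $x_n\in S_n$ ($n\in N$) with $\lim_{n\in N}x_n=x$; $\limsup_{n\to\infty}S_n$ is the set of $x$ for which there exist an infinite $N\subset\mathbb{N}$ and $x_n\in S_n$ ($n\in N$) with $\lim_{n\in N}x_n=x$. Strong (weak) cluster points of a sequence are norm (weak) limits of its subsequences.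
   Formalization: In the second sentences of items 7 and 9, strong convergence of (u_n) to u_* is assumed in addition to the set of strong cluster points being {u_*}; with the singleton condition alone both sentences fail in infinite dimension. *)

theory Defs
  imports "HOL-Analysis.Analysis"
begin

definition Fix :: "('a \<Rightarrow> 'a) \<Rightarrow> 'a set" where
  "Fix T = {v. T v = v}"

definition lev0 :: "('a \<Rightarrow> real) \<Rightarrow> 'a set" where
  "lev0 \<theta> = {v. \<theta> v \<le> 0}"

definition attracting_qne :: "real \<Rightarrow> ('a::real_inner \<Rightarrow> 'a) \<Rightarrow> bool" where
  "attracting_qne \<eta> T \<longleftrightarrow> \<eta> > 0 \<and> Fix T \<noteq> {} \<and>
     (\<forall>x. \<forall>v \<in> Fix T.
        \<eta> * (norm (x - T x))\<^sup>2 \<le> (norm (x - v))\<^sup>2 - (norm (T x - v))\<^sup>2)"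

definition strongly_attracting_qne :: "('a::real_inner \<Rightarrow> 'a) \<Rightarrow> bool" where
  "strongly_attracting_qne T \<longleftrightarrow> (\<exists>\<eta>>0. attracting_qne \<eta> T)"

definition subdifferential :: "('a::real_inner \<Rightarrow> real) \<Rightarrow> 'a \<Rightarrow> 'a set" where
  "subdifferential \<theta> x = {v. \<forall>y. v \<bullet> (y - x) + \<theta> x \<le> \<theta> y}"

text \<open>In the next two definitions \<open>g\<close> is a selection of subgradients of \<open>\<theta>\<close>. If \<open>lev0 \<theta>\<close> is nonempty,
  then \<open>g x \<noteq> 0\<close> whenever \<open>\<theta> x > 0\<close>; otherwise the quotient may be a division by zero.\<close>

definition subgradient_projection ::
    "('a::real_inner \<Rightarrow> real) \<Rightarrow> ('a \<Rightarrow> 'a) \<Rightarrow> 'a \<Rightarrow> 'a" where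
  "subgradient_projection \<theta> g x =
     (if \<theta> x > 0 then x - (\<theta> x / (norm (g x))\<^sup>2) *\<^sub>R g x else x)"

definition relaxed_subgradient_projection ::
    "real \<Rightarrow> ('a::real_inner \<Rightarrow> real) \<Rightarrow> ('a \<Rightarrow> 'a) \<Rightarrow> 'a \<Rightarrow> 'a" where
  "relaxed_subgradient_projection l \<theta> g x = x + l *\<^sub>R (subgradient_projection \<theta> g x - x)"

text \<open>The filter for limits as \<open>n\<close> tends to infinity inside the infinite index set \<open>M\<close>.\<close>

definition along :: "nat set \<Rightarrow> nat filter" where
  "along M = inf sequentially (principal M)"

text \<open>\<open>N\<close> is the set of indices for which the mappings are considered. The limit inferior is taken
  in the extended reals because it may be infinite. All \<open>Fix (R n)\<close> with \<open>n \<in> N\<close> are meant to be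
  nonempty (\<^const>\<open>infdist\<close> to the empty set is 0).\<close>

definition condition_L :: "nat set \<Rightarrow> (nat \<Rightarrow> 'a::real_inner \<Rightarrow> 'a) \<Rightarrow> bool" where
  "condition_L N R \<longleftrightarrow>
     (\<forall>M x \<gamma>. M \<subseteq> N \<and> infinite M \<and> \<gamma> > 0 \<and> (\<forall>n\<in>M. infdist (x n) (Fix (R n)) \<ge> \<gamma>) \<longrightarrow>
        (\<exists>\<delta>>0. Liminf (along M) (\<lambda>n. ereal (norm (x n - R n (x n)))) \<ge> ereal \<delta>))"

definition weakly_converges :: "(nat \<Rightarrow> 'a::real_normed_vector) \<Rightarrow> 'a \<Rightarrow> bool" where
  "weakly_converges x l \<longleftrightarrow>
     (\<forall>f :: 'a \<Rightarrow> real. bounded_linear f \<longrightarrow> (\<lambda>n. f (x n)) \<longlonglongrightarrow> f l)"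

definition demiclosed_at_0 :: "('a::real_normed_vector \<Rightarrow> 'a) \<Rightarrow> bool" where
  "demiclosed_at_0 R \<longleftrightarrow>
     (\<forall>x l. weakly_converges x l \<and> (\<lambda>n. R (x n)) \<longlonglongrightarrow> 0 \<longrightarrow> R l = 0)"

definition strong_cluster_points :: "(nat \<Rightarrow> 'a::real_normed_vector) \<Rightarrow> 'a set" where
  "strong_cluster_points u = {l. \<exists>r. strict_mono r \<and> (u \<circ> r) \<longlonglongrightarrow> l}"

definition weak_cluster_points :: "(nat \<Rightarrow> 'a::real_normed_vector) \<Rightarrow> 'a set" where
  "weak_cluster_points u = {l. \<exists>r. strict_mono r \<and> weakly_converges (u \<circ> r) l}"

definition liminf_sets :: "(nat \<Rightarrow> 'a::real_normed_vector set) \<Rightarrow> 'a set" where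
  "liminf_sets S =
     {l. \<exists>N x. finite (- N) \<and> (\<forall>n\<in>N. x n \<in> S n) \<and> (x \<longlongrightarrow> l) (along N)}"

definition limsup_sets :: "(nat \<Rightarrow> 'a::real_normed_vector set) \<Rightarrow> 'a set" where
  "limsup_sets S =
     {l. \<exists>N x. infinite N \<and> (\<forall>n\<in>N. x n \<in> S n) \<and> (x \<longlongrightarrow> l) (along N)}"

definition ri :: "'a::real_normed_vector set \<Rightarrow> 'a set \<Rightarrow> 'a set" where
  "ri Y S = {v \<in> S. \<exists>\<rho>>0. ball v \<rho> \<inter> Y \<noteq> {} \<and> ball v \<rho> \<inter> Y \<subseteq> S}"

text \<open>Codimension one of the direction space \<open>V\<close>: it is proper, and one further vector spans
  the whole space together with \<open>V\<close>.\<close>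

definition hyperplane :: "'a::real_normed_vector set \<Rightarrow> bool" where
  "hyperplane P \<longleftrightarrow> closed P \<and>
     (\<exists>a V. subspace V \<and> P = (+) a ` V \<and> (\<exists>w. w \<notin> V \<and> span (insert w V) = UNIV))"

definition Omega_at :: "(nat \<Rightarrow> 'a \<Rightarrow> 'a) \<Rightarrow> (nat \<Rightarrow> 'a \<Rightarrow> real) \<Rightarrow> nat \<Rightarrow> 'a set" where
  "Omega_at T \<theta> n = Fix (T n) \<inter> lev0 (\<theta> n)"

definition Omega :: "(nat \<Rightarrow> 'a \<Rightarrow> 'a) \<Rightarrow> (nat \<Rightarrow> 'a \<Rightarrow> real) \<Rightarrow> nat set \<Rightarrow> 'a set" where
  "Omega T \<theta> N = (\<Inter>n\<in>N. Omega_at T \<theta> n)"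

definition relaxation_bounded :: "(nat \<Rightarrow> real) \<Rightarrow> bool" where
  "relaxation_bounded l \<longleftrightarrow> (\<exists>\<epsilon>. 0 < \<epsilon> \<and> \<epsilon> \<le> 1 \<and> (\<forall>n. l n \<in> {\<epsilon>..2 - \<epsilon>}))"

definition attraction_bounded :: "(nat \<Rightarrow> real) \<Rightarrow> bool" where
  "attraction_bounded \<eta> \<longleftrightarrow>
     bdd_below (range \<eta>) \<and> 0 < (INF n. \<eta> n) \<and> bdd_above (range \<eta>)"

definition common_strongly_attracting ::
    "(nat \<Rightarrow> 'a::real_inner \<Rightarrow> 'a) \<Rightarrow> ('a \<Rightarrow> 'a) \<Rightarrow> bool" where
  "common_strongly_attracting T S \<longleftrightarrow>
     (\<forall>n. T n = S) \<and> strongly_attracting_qne S \<and> Fix S \<noteq> {} \<and> demiclosed_at_0 (\<lambda>x. x - S x)"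

end

theory Submission
  imports Defs "HOL-Library.Diagonal_Subsequence"
begin

text \<open>The decrement has two summands because an iteration step is a relaxed projection
  followed by \<open>T n\<close>, and each factor contributes its own loss. Their weights are
  \<open>l n * (2 - l n)\<close> and the attraction constant: (A3) keeps the first away from zero,
  (A5) the second, and under (A8) a single constant serves every index. The space may be
  nonseparable, so the diagonal argument behind weak compactness tests only against the terms of the
  sequence itself; orthogonal projection disposes of all other directions. Distances to points of a
  hyperplane do not distinguish a point from its mirror image. Fejer monotonicity with respect to a
  disc therefore cannot fix the side of the hyperplane on which the sequence settles, and this is
  what the vanishing steps decide.\<close>

text \<open>Every point \<open>v\<close> of \<open>Omega\<close> makes \<open>norm (u n - v)\<close> decrease, and the decrement of its square bounds
  both \<open>(\<theta> n (u n) / norm (g n (u n)))\<^sup>2\<close> and \<open>(norm (y n - T n (y n)))\<^sup>2\<close>, where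
  \<open>y n\<close> is the relaxed subgradient projection of \<open>u n\<close>. The decrements telescope, so both quantities
  tend to zero. Weak cluster points come from weak sequential compactness. If \<open>Omega\<close> contains a disc
  of a hyperplane, Fejer monotonicity with respect to the disc and vanishing steps give convergence.\<close>

section \<open>Hilbert space\<close>

text \<open>The representative is the minimizer over \<open>V\<close> of the quadratic functional
  \<open>J\<close>; stationarity in the directions of \<open>V\<close> is the claim. Stating it for
  a closed subspace yields both orthogonal projections and, for \<open>V = UNIV\<close>, the dual of
  the whole space.\<close>

lemma riesz_on_closed_subspace:
  fixes f :: "'a::{real_inner, complete_space} \<Rightarrow> real"
  assumes V: "closed V" "subspace V" and f: "bounded_linear f"
  shows "\<exists>z\<in>V. \<forall>y\<in>V. f y = z \<bullet> y"
proof -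
  interpret f: bounded_linear f by (rule f)
  define J where "J y = y \<bullet> y - 2 * f y" for y
  define m where "m = (INF y\<in>V. J y)"
  obtain K where K: "\<And>y. norm (f y) \<le> norm y * K"
    using f.bounded by blast
  have lower: "- K\<^sup>2 \<le> J y" for y
  proof -
    have "0 \<le> (norm y - K)\<^sup>2" by simp
    then show ?thesis
      using K[of y] by (simp add: J_def power2_eq_square algebra_simps dot_square_norm)
  qed
  have bdd: "bdd_below (J ` V)"
    by (rule bdd_belowI2[OF lower])
  have ne: "V \<noteq> {}"
    using V(2) subspace_0 by blast
  have m_le: "m \<le> J y" if "y \<in> V" for y
    unfolding m_def by (rule cINF_lower[OF bdd that])
  have "\<exists>y\<in>V. J y < m + 1 / real (Suc n)" for n
    using cINF_less_iff[OF ne bdd, of "m + 1 / real (Suc n)"] by (simp add: m_def)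
  then obtain y where yV: "\<And>n. y n \<in> V" and yJ: "\<And>n. J (y n) < m + 1 / real (Suc n)"
    by metis
  \<comment> \<open>Parallelogram identity: the linear parts cancel in
    \<open>2 * J a + 2 * J b - 4 * J ((1/2) *\<^sub>R (a + b))\<close>, which leaves the squared
    distance. Minimizing sequences are therefore Cauchy.\<close>
  have gap: "(norm (a - b))\<^sup>2 \<le> 2 * (J a + J b - 2 * m)" if "a \<in> V" "b \<in> V" for a b
  proof -
    have "(1/2) *\<^sub>R (a + b) \<in> V"
      using that V(2) by (intro subspace_scale subspace_add)
    from m_le[OF this] show ?thesis
      by (simp add: J_def f.scaleR f.add dot_square_norm[symmetric] inner_commute algebra_simps)
  qed
  have J_lim: "(\<lambda>n. J (y n)) \<longlonglongrightarrow> m"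
  proof (rule tendsto_sandwich)
    show "\<forall>\<^sub>F n in sequentially. m \<le> J (y n)"
      using m_le yV by simp
    show "\<forall>\<^sub>F n in sequentially. J (y n) \<le> m + 1 / real (Suc n)"
      using yJ by (simp add: less_imp_le)
    show "(\<lambda>n. m + 1 / real (Suc n)) \<longlonglongrightarrow> m"
      using tendsto_add[OF tendsto_const LIMSEQ_inverse_real_of_nat, of m]
      by (simp add: inverse_eq_divide)
  qed simp
  have "Cauchy y"
  proof (rule metric_CauchyI)
    fix e :: real assume "e > 0"
    then have "\<forall>\<^sub>F n in sequentially. J (y n) < m + e\<^sup>2 / 4"
      by (intro order_tendstoD(2)[OF J_lim]) simp
    then obtain n0 where n0: "\<And>n. n \<ge> n0 \<Longrightarrow> J (y n) < m + e\<^sup>2 / 4"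
      by (auto simp: eventually_sequentially)
    have "dist (y i) (y j) < e" if "i \<ge> n0" "j \<ge> n0" for i j
    proof -
      have "(norm (y i - y j))\<^sup>2 < e\<^sup>2"
        using gap[OF yV yV, of i j] n0[OF that(1)] n0[OF that(2)] by argo
      then show ?thesis
        using \<open>e > 0\<close> by (simp add: dist_norm power2_less_imp_less)
    qed
    then show "\<exists>M. \<forall>i\<ge>M. \<forall>j\<ge>M. dist (y i) (y j) < e" by blast
  qed
  then obtain z where z: "y \<longlonglongrightarrow> z"
    using Cauchy_convergent convergent_def by blast
  have zV: "z \<in> V"
    using closed_sequentially[OF V(1)] yV z by blast
  have "(\<lambda>n. J (y n)) \<longlonglongrightarrow> J z"
    unfolding J_def by (intro tendsto_intros z f.tendsto)
  then have Jz: "J z = m"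
    using J_lim LIMSEQ_unique by blast
  have "f v = z \<bullet> v" if "v \<in> V" for v
  proof (cases "v = 0")
    case False
    define c where "c = z \<bullet> v - f v"
    \<comment> \<open>This \<open>t\<close> minimizes the quadratic
      \<open>2 * t * c + t\<^sup>2 * (v \<bullet> v)\<close>, the change of \<open>J\<close> when
      moving from \<open>z\<close> to \<open>z + t *\<^sub>R v\<close>.\<close>
    define t where "t = - c / (v \<bullet> v)"
    have "z + t *\<^sub>R v \<in> V"
      using zV that V(2) by (intro subspace_add subspace_scale)
    from m_le[OF this] have "0 \<le> 2 * t * c + t\<^sup>2 * (v \<bullet> v)"
      unfolding Jz[symmetric] J_def c_def
      by (simp add: f.scaleR f.add inner_commute power2_eq_square algebra_simps)
    also have "\<dots> = - (c\<^sup>2 / (v \<bullet> v))"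
      using False by (simp add: t_def power2_eq_square field_simps)
    finally have "c\<^sup>2 / (v \<bullet> v) \<le> 0" by simp
    then have "c = 0"
      using False inner_gt_zero_iff[of v] by (simp add: divide_le_0_iff not_le[symmetric])
    then show ?thesis by (simp add: c_def)
  qed (simp add: f.zero)
  then show ?thesis using zV by blast
qed

text \<open>The projection is the representative on \<open>V\<close> of the functional given by the
  inner product with \<open>x\<close>.\<close>

lemma orthogonal_projection_exists:
  fixes x :: "'a::{real_inner, complete_space}"
  assumes "closed V" "subspace V"
  shows "\<exists>p\<in>V. \<forall>y\<in>V. (x - p) \<bullet> y = 0"
  using riesz_on_closed_subspace[OF assms bounded_linear_inner_right[of x]]
  by (auto simp: inner_diff_left)

section \<open>Weak sequential compactness of bounded sequences\<close>

lemma subspace_convergent_inner: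
  "subspace {y. convergent (\<lambda>k. x k \<bullet> y)}"
  by (auto simp: subspace_def inner_add_right convergent_add intro: convergent_mult convergent_const)

text \<open>Boundedness of \<open>x\<close> makes \<open>x k \<bullet> s j\<close> approximate
  \<open>x k \<bullet> l\<close> uniformly in \<open>k\<close>, so a three-epsilon argument
  applies.\<close>

lemma closed_convergent_inner:
  fixes x :: "nat \<Rightarrow> 'a::real_inner"
  assumes "bounded (range x)"
  shows "closed {y. convergent (\<lambda>k. x k \<bullet> y)}"
proof -
  obtain B where B: "\<And>k. norm (x k) \<le> B" and "B > 0"
    using assms by (auto simp: bounded_pos)
  have "convergent (\<lambda>k. x k \<bullet> l)"
    if s: "\<And>n. convergent (\<lambda>k. x k \<bullet> s n)" and lim: "s \<longlonglongrightarrow> l" for s l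
  proof (rule Cauchy_convergent, rule metric_CauchyI)
    fix e :: real assume "e > 0"
    then obtain j where j: "dist (s j) l < e / (3 * B)"
      using lim \<open>B > 0\<close> by (metis LIMSEQ_def divide_pos_pos mult_pos_pos order_refl zero_less_numeral)
    have near: "\<bar>x k \<bullet> s j - x k \<bullet> l\<bar> < e / 3" for k
    proof -
      have "\<bar>x k \<bullet> s j - x k \<bullet> l\<bar> \<le> norm (x k) * norm (s j - l)"
        by (metis Cauchy_Schwarz_ineq2 inner_diff_right)
      also have "\<dots> \<le> B * norm (s j - l)"
        using B by (simp add: mult_right_mono)
      also have "\<dots> < e / 3"
        using j \<open>B > 0\<close> by (simp add: dist_norm field_simps)
      finally show ?thesis .
    qed
    obtain M where M: "\<And>i k. i \<ge> M \<Longrightarrow> k \<ge> M \<Longrightarrow> dist (x i \<bullet> s j) (x k \<bullet> s j) < e / 3"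
      using metric_CauchyD[OF convergent_Cauchy[OF s[of j]], of "e / 3"] \<open>e > 0\<close> by auto
    have "dist (x i \<bullet> l) (x k \<bullet> l) < e" if "i \<ge> M" "k \<ge> M" for i k
      using near[of i] near[of k] M[OF that] unfolding dist_real_def by linarith
    then show "\<exists>M. \<forall>i\<ge>M. \<forall>k\<ge>M. dist (x i \<bullet> l) (x k \<bullet> l) < e" by blast
  qed
  then show ?thesis
    by (auto simp: closed_sequential_limits)
qed

lemma bounded_imp_weakly_convergent_subseq:
  fixes x :: "nat \<Rightarrow> 'a::{real_inner, complete_space}"
  assumes "bounded (range x)"
  shows "\<exists>r z. strict_mono r \<and> weakly_converges (x \<circ> r) z"
proof -
  obtain B where B: "\<And>k. norm (x k) \<le> B"
    using assms by (auto simp: bounded_iff)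
  \<comment> \<open>Only countably many tests are imposed, one for each term \<open>x m\<close>; no
    dense sequence in the space is needed.\<close>
  interpret subseqs "\<lambda>m s. convergent (\<lambda>k. x (s k) \<bullet> x m)"
  proof
    fix m and s :: "nat \<Rightarrow> nat"
    have "bounded (range (\<lambda>k. x (s k) \<bullet> x m))"
      unfolding bounded_iff
    proof (intro exI[of _ "B * norm (x m)"] ballI)
      fix t assume "t \<in> range (\<lambda>k. x (s k) \<bullet> x m)"
      then obtain k where "t = x (s k) \<bullet> x m" by blast
      then show "norm t \<le> B * norm (x m)"
        using Cauchy_Schwarz_ineq2[of "x (s k)" "x m"]
          mult_right_mono[OF B[of "s k"], of "norm (x m)"] by auto
    qed
    then show "\<exists>r'. strict_mono r' \<and> convergent (\<lambda>k. x ((s \<circ> r') k) \<bullet> x m)"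
      using bounded_imp_convergent_subsequence[of "\<lambda>k. x (s k) \<bullet> x m"]
      by (auto simp: o_def convergent_def)
  qed
  define w where "w = x \<circ> diagseq"
  define D where "D = {y. convergent (\<lambda>k. w k \<bullet> y)}"
  have w_bdd: "bounded (range w)"
    using assms by (rule bounded_subset) (auto simp: w_def)
  have closed_D: "closed D" and sub_D: "subspace D"
    unfolding D_def by (rule closed_convergent_inner[OF w_bdd], rule subspace_convergent_inner)
  have x_in_D: "x m \<in> D" for m
  proof -
    \<comment> \<open>The diagonal sequence is a subsequence of the \<open>m\<close>-th extraction
      only after its first \<open>Suc m\<close> terms; dropping them does not affect
      convergence.\<close>
    have "convergent (\<lambda>k. x ((diagseq \<circ> (+) (Suc m)) k) \<bullet> x m)"
    proof (rule diagseq_holds)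
      fix r s :: "nat \<Rightarrow> nat" and n
      assume "strict_mono r" "convergent (\<lambda>k. x (s k) \<bullet> x n)"
      then show "convergent (\<lambda>k. x ((s \<circ> r) k) \<bullet> x n)"
        using convergent_subseq_convergent[of "\<lambda>k. x (s k) \<bullet> x n" r] by (simp add: o_def)
    qed
    then show ?thesis
      using convergent_ignore_initial_segment[of "\<lambda>k. w k \<bullet> x m" "Suc m"]
      by (simp add: D_def w_def add.commute)
  qed
  \<comment> \<open>\<open>D\<close> is a closed subspace containing the sequence and everything orthogonal to the sequence.\<close>
  have "y \<in> D" for y
  proof -
    obtain p where p: "p \<in> D" "\<And>v. v \<in> D \<Longrightarrow> (y - p) \<bullet> v = 0"
      using orthogonal_projection_exists[OF closed_D sub_D] by blast
    have "w k \<bullet> (y - p) = 0" for k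
      using p(2)[OF x_in_D] by (simp add: w_def inner_commute[of _ "y - p"])
    then have "y - p \<in> D"
      by (simp add: D_def convergent_const)
    then show ?thesis
      using p(1) sub_D subspace_add by fastforce
  qed
  then have lim: "(\<lambda>k. w k \<bullet> y) \<longlonglongrightarrow> lim (\<lambda>k. w k \<bullet> y)" for y
    by (simp add: D_def convergent_LIMSEQ_iff)
  \<comment> \<open>The pointwise limits form a functional bounded by \<open>B\<close>; its Riesz
    representative is the weak limit.\<close>
  have "bounded_linear (\<lambda>y. lim (\<lambda>k. w k \<bullet> y))"
  proof (rule bounded_linear_intro[where K = B])
    show "lim (\<lambda>k. w k \<bullet> (y + z)) = lim (\<lambda>k. w k \<bullet> y) + lim (\<lambda>k. w k \<bullet> z)" for y z
      using tendsto_add[OF lim lim] by (auto simp: inner_add_right intro: limI)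
    show "lim (\<lambda>k. w k \<bullet> (c *\<^sub>R y)) = c *\<^sub>R lim (\<lambda>k. w k \<bullet> y)" for c y
      using tendsto_mult_left[OF lim] by (auto intro: limI)
    show "norm (lim (\<lambda>k. w k \<bullet> y)) \<le> norm y * B" for y
    proof (rule Lim_bounded[OF tendsto_norm[OF lim]])
      show "\<forall>n\<ge>0. norm (w n \<bullet> y) \<le> norm y * B"
      proof (intro allI impI)
        fix n
        show "norm (w n \<bullet> y) \<le> norm y * B"
          using Cauchy_Schwarz_ineq2[of "w n" y] mult_right_mono[OF B, of "norm y" "diagseq n"]
          by (simp add: w_def mult.commute)
      qed
    qed
  qed
  then obtain z where z: "\<And>y. lim (\<lambda>k. w k \<bullet> y) = z \<bullet> y"
    using riesz_on_closed_subspace[of UNIV] by auto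
  have "weakly_converges w z"
    unfolding weakly_converges_def
  proof (intro allI impI)
    fix f :: "'a \<Rightarrow> real" assume "bounded_linear f"
    then obtain a where "\<And>y. f y = a \<bullet> y"
      using riesz_on_closed_subspace[of UNIV f] by auto
    then show "(\<lambda>n. f (w n)) \<longlonglongrightarrow> f z"
      using lim[of a] by (simp add: z inner_commute[of a])
  qed
  then show ?thesis
    using subseq_diagseq by (auto simp: w_def)
qed

text \<open>The unit normal is the normalized component of the extra vector \<open>w\<close>
  orthogonal to the direction space \<open>V\<close>. It is nonzero because \<open>w\<close> lies
  outside \<open>V\<close>, and codimension one puts everything orthogonal to it into
  \<open>V\<close>.\<close>

lemma hyperplane_normal_form:
  fixes P :: "'a::{real_inner, complete_space} set"
  assumes P: "hyperplane P" and v: "v \<in> P"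
  obtains e where "norm e = 1" "\<And>y. y \<bullet> e = 0 \<Longrightarrow> v + y \<in> P"
proof -
  obtain a V w where P_eq: "P = (+) a ` V" and V: "subspace V" "closed P" 
    and w: "w \<notin> V" "span (insert w V) = UNIV"
    using P by (auto simp: hyperplane_def)
  have "V = (+) (- a) ` P"
    by (auto simp: P_eq image_image)
  then have "closed V"
    using V(2) closed_translation by metis
  then obtain p where p: "p \<in> V" "\<And>y. y \<in> V \<Longrightarrow> (w - p) \<bullet> y = 0"
    using orthogonal_projection_exists[of V w] V(1) by blast
  define n where "n = w - p"
  have "n \<noteq> 0"
    using p(1) w(1) by (auto simp: n_def)
  have perp: "y \<in> V" if "y \<bullet> n = 0" for y
  proof -
    have "y \<in> span (insert w V)" using w(2) by simp
    then obtain k where "y - k *\<^sub>R w \<in> V"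
      using V(1) by (auto simp: span_breakdown_eq span_eq_iff[THEN iffD2])
    \<comment> \<open>Since \<open>n\<close> and \<open>w\<close> differ by \<open>p\<close>, which
      lies in \<open>V\<close>, the vector \<open>w\<close> may be replaced by \<open>n\<close> in
      the decomposition; orthogonality then forces \<open>k = 0\<close>.\<close>
    from subspace_add[OF V(1) this subspace_scale[OF V(1) p(1), of k]]
    have k: "y - k *\<^sub>R n \<in> V"
      by (simp add: n_def algebra_simps)
    have "0 = n \<bullet> (y - k *\<^sub>R n)"
      using p(2)[OF k] by (simp add: n_def)
    also have "\<dots> = - (k * (n \<bullet> n))"
      using that by (simp add: inner_diff_right inner_commute)
    finally have "k = 0" using \<open>n \<noteq> 0\<close> by simp
    then show ?thesis using k by simp
  qed
  show thesis
  proof (rule that[of "sgn n"])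
    show "norm (sgn n) = 1" using \<open>n \<noteq> 0\<close> by (simp add: norm_sgn)
    fix y assume "y \<bullet> sgn n = 0"
    then have "y \<in> V" using \<open>n \<noteq> 0\<close> perp by (simp add: sgn_div_norm)
    moreover obtain b where "b \<in> V" "v = a + b" using v P_eq by auto
    ultimately show "v + y \<in> P"
      using V(1) by (simp add: P_eq add.assoc image_iff subspace_add)
  qed
qed

section \<open>Sequences\<close>

lemma eventually_mem_cofinite:
  assumes "finite (- N)"
  shows "\<forall>\<^sub>F n::nat in sequentially. n \<in> N"
  using assms by (simp add: eventually_cofinite Compl_eq flip: cofinite_eq_sequentially)

lemma infdist_mono_dist:
  assumes "\<And>v. v \<in> A \<Longrightarrow> dist y v \<le> dist x v"
  shows "infdist y A \<le> infdist x A"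
proof (cases "A = {}")
  case False
  then show ?thesis
    using assms by (auto simp: infdist_notempty intro!: cINF_mono)
qed (simp add: infdist_def)

lemma tendsto_alongI:
  assumes "(x \<longlongrightarrow> l) sequentially"
  shows "(x \<longlongrightarrow> l) (along N)"
  using assms unfolding along_def by (rule filterlim_mono) auto

lemma along_neq_bot:
  assumes "infinite N"
  shows "along N \<noteq> bot"
  using assms by (auto simp: along_def trivial_limit_def eventually_inf_principal
      eventually_sequentially infinite_nat_iff_unbounded_le)

text \<open>Translates between the two views of a subsequence: cluster points use a strictly
  increasing \<open>r\<close>, whereas \<open>limsup_sets\<close> uses an infinite index
  set.\<close>

lemma tendsto_along_range:
  assumes r: "strict_mono r" and lim: "(x \<circ> r) \<longlonglongrightarrow> l"
  shows "(x \<longlongrightarrow> l) (along (range r))"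
proof (rule topological_tendstoI)
  fix S assume "open S" "l \<in> S"
  then obtain K where K: "\<And>k. k \<ge> K \<Longrightarrow> x (r k) \<in> S"
    using topological_tendstoD[OF lim] by (fastforce simp: eventually_sequentially)
  have "x n \<in> S" if "n \<ge> r K" "n \<in> range r" for n
    using that K strict_mono_less_eq[OF r] by auto
  then show "\<forall>\<^sub>F n in along (range r). x n \<in> S"
    by (auto simp: along_def eventually_inf_principal eventually_sequentially)
qed

text \<open>If the distances stayed above \<open>e\<close> on an infinite index set, (L) on that set
  would give the residuals a positive limit inferior, contradicting their convergence to
  zero.\<close>

lemma condition_L_infdist_tendsto_0:
  assumes L: "condition_L N R" and N: "finite (- N)"
    and lim: "(\<lambda>n. norm (x n - R n (x n))) \<longlonglongrightarrow> 0"
  shows "(\<lambda>n. infdist (x n) (Fix (R n))) \<longlonglongrightarrow> 0"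
proof (rule order_tendstoI)
  fix e :: real assume "e > 0"
  define M where "M = {n \<in> N. infdist (x n) (Fix (R n)) \<ge> e}"
  have "finite M"
  proof (rule ccontr)
    assume inf: "infinite M"
    then obtain \<delta> where "\<delta> > 0"
      and \<delta>: "Liminf (along M) (\<lambda>n. ereal (norm (x n - R n (x n)))) \<ge> ereal \<delta>"
      using L[unfolded condition_L_def, rule_format, of M e x] \<open>e > 0\<close> by (auto simp: M_def)
    have "((\<lambda>n. ereal (norm (x n - R n (x n)))) \<longlongrightarrow> ereal 0) (along M)"
      using tendsto_alongI[OF lim] by (simp add: tendsto_ereal)
    then have "Liminf (along M) (\<lambda>n. ereal (norm (x n - R n (x n)))) = ereal 0"
      by (rule lim_imp_Liminf[OF along_neq_bot[OF inf]])
    then show False using \<delta> \<open>\<delta> > 0\<close> by simp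
  qed
  then have "\<forall>\<^sub>F n in sequentially. n \<notin> M"
    by (intro eventually_mem_cofinite[of "- M", simplified])
  then show "\<forall>\<^sub>F n in sequentially. infdist (x n) (Fix (R n)) < e"
    using eventually_mem_cofinite[OF N] by eventually_elim (auto simp: M_def)
next
  fix e :: real assume "e < 0"
  then show "\<forall>\<^sub>F n in sequentially. e < infdist (x n) (Fix (R n))"
    by (intro always_eventually allI less_le_trans[OF _ infdist_nonneg])
qed

text \<open>Nearest points need not exist in arbitrary sets \<open>S n\<close>, so the selection
  allows a slack of \<open>1 / real (Suc n)\<close>, which vanishes in the limit.\<close>

lemma near_selection:
  fixes u :: "nat \<Rightarrow> 'a::real_normed_vector"
  assumes ne: "\<And>n. n \<in> N \<Longrightarrow> S n \<noteq> {}" and N: "finite (- N)"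
    and d: "(\<lambda>n. infdist (u n) (S n)) \<longlonglongrightarrow> 0"
  obtains x where "\<And>n. n \<in> N \<Longrightarrow> x n \<in> S n" "(\<lambda>n. x n - u n) \<longlonglongrightarrow> 0"
proof -
  have "\<exists>y. y \<in> S n \<and> dist (u n) y < infdist (u n) (S n) + 1 / real (Suc n)" if "n \<in> N" for n
    using cINF_less_iff[OF ne[OF that], of "dist (u n)" "infdist (u n) (S n) + 1 / real (Suc n)"]
    by (auto simp: infdist_notempty[OF ne[OF that]])
  then obtain x where x: "\<And>n. n \<in> N \<Longrightarrow> x n \<in> S n"
    and close: "\<And>n. n \<in> N \<Longrightarrow> dist (u n) (x n) < infdist (u n) (S n) + 1 / real (Suc n)"
    by metis
  have "(\<lambda>n. x n - u n) \<longlonglongrightarrow> 0"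
  proof (rule Lim_null_comparison)
    show "\<forall>\<^sub>F n in sequentially. norm (x n - u n) \<le> infdist (u n) (S n) + 1 / real (Suc n)"
      using eventually_mem_cofinite[OF N]
      by eventually_elim (use close in \<open>force simp: dist_norm norm_minus_commute\<close>)
    show "(\<lambda>n. infdist (u n) (S n) + 1 / real (Suc n)) \<longlonglongrightarrow> 0"
      using tendsto_add[OF d LIMSEQ_inverse_real_of_nat] by (simp add: inverse_eq_divide)
  qed
  with x show thesis by (rule that)
qed

text \<open>The nearby points selected from the sets share every subsequential limit of
  \<open>u\<close>. The witnessing index set is \<open>range r \<inter> N\<close>, still infinite
  because \<open>N\<close> omits only finitely many indices.\<close>

lemma strong_cluster_points_subset_limsup_sets:
  assumes ne: "\<And>n. n \<in> N \<Longrightarrow> S n \<noteq> {}" and N: "finite (- N)"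
    and d: "(\<lambda>n. infdist (u n) (S n)) \<longlonglongrightarrow> 0"
  shows "strong_cluster_points u \<subseteq> limsup_sets S"
proof
  fix l assume "l \<in> strong_cluster_points u"
  then obtain r where r: "strict_mono r" "(u \<circ> r) \<longlonglongrightarrow> l"
    by (auto simp: strong_cluster_points_def)
  obtain x where x: "\<And>n. n \<in> N \<Longrightarrow> x n \<in> S n" "(\<lambda>n. x n - u n) \<longlonglongrightarrow> 0"
    using near_selection[OF ne N d] by blast
  have "(\<lambda>k. (x \<circ> r) k - (u \<circ> r) k) \<longlonglongrightarrow> 0"
    using LIMSEQ_subseq_LIMSEQ[OF x(2) r(1)] by (simp add: o_def)
  then have "(x \<circ> r) \<longlonglongrightarrow> l"
    using tendsto_add[OF _ r(2), of "\<lambda>k. (x \<circ> r) k - (u \<circ> r) k" 0] by (simp add: o_def)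
  then have "(x \<longlongrightarrow> l) (along (range r))"
    by (rule tendsto_along_range[OF r(1)])
  then have "(x \<longlongrightarrow> l) (along (range r \<inter> N))"
    by (rule filterlim_mono) (auto simp: along_def intro: le_infI2)
  moreover have "infinite (range r \<inter> N)"
  proof -
    have "range r \<subseteq> (range r \<inter> N) \<union> - N" by blast
    then show ?thesis
      using N range_inj_infinite[OF strict_mono_imp_inj_on[OF r(1)]] finite_subset by blast
  qed
  ultimately show "l \<in> limsup_sets S"
    using x(1) by (auto simp: limsup_sets_def)
qed

text \<open>The limit inferior demands points at all but finitely many indices, so convergence of
  the whole sequence is assumed. In infinite dimension a single strong cluster point does not give
  it: other subsequences may have no strong cluster point at all.\<close>

lemma lim_in_liminf_sets:
  assumes ne: "\<And>n. n \<in> N \<Longrightarrow> S n \<noteq> {}" and N: "finite (- N)"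
    and d: "(\<lambda>n. infdist (u n) (S n)) \<longlonglongrightarrow> 0" and lim: "u \<longlonglongrightarrow> l"
  shows "l \<in> liminf_sets S"
proof -
  obtain x where x: "\<And>n. n \<in> N \<Longrightarrow> x n \<in> S n" "(\<lambda>n. x n - u n) \<longlonglongrightarrow> 0"
    using near_selection[OF ne N d] by blast
  have "x \<longlonglongrightarrow> l"
    using tendsto_add[OF x(2) lim] by simp
  then have "(x \<longlongrightarrow> l) (along N)"
    by (rule tendsto_alongI)
  then show ?thesis
    using N x(1) by (auto simp: liminf_sets_def)
qed

lemma strong_cluster_points_of_convergent:
  assumes "u \<longlonglongrightarrow> l"
  shows "strong_cluster_points u = {l}"
proof -
  have "(u \<circ> r) \<longlonglongrightarrow> l" if "strict_mono r" for r
    by (rule LIMSEQ_subseq_LIMSEQ[OF assms that])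
  then show ?thesis
    unfolding strong_cluster_points_def
    by (auto dest: LIMSEQ_unique intro!: exI[of _ id] simp: strict_mono_def assms)
qed

lemma strong_cluster_points_subset_weak:
  "strong_cluster_points u \<subseteq> weak_cluster_points u"
proof
  fix l assume "l \<in> strong_cluster_points u"
  then obtain r where r: "strict_mono r" "(u \<circ> r) \<longlonglongrightarrow> l"
    by (auto simp: strong_cluster_points_def)
  then have "weakly_converges (u \<circ> r) l"
    unfolding weakly_converges_def o_def by (auto intro: bounded_linear.tendsto)
  with r(1) show "l \<in> weak_cluster_points u"
    by (auto simp: weak_cluster_points_def)
qed

section \<open>Convergence criteria\<close>

lemma convergent_of_telescoping_bound:
  fixes p :: "nat \<Rightarrow> 'a::{real_normed_vector, complete_space}"
  assumes step: "\<And>n. norm (p n - p (Suc n)) \<le> a n - a (Suc n)" and a: "convergent a"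
  shows "convergent p"
proof (rule Cauchy_convergent, rule metric_CauchyI)
  have bound: "dist (p n) (p (n + k)) \<le> a n - a (n + k)" for n k
  proof (induction k)
    case (Suc k)
    then show ?case
      using step[of "n + k"] dist_triangle[of "p n" "p (Suc (n + k))" "p (n + k)"]
      by (simp add: dist_norm)
  qed simp
  fix e :: real assume "e > 0"
  then obtain M where M: "\<And>m n. m \<ge> M \<Longrightarrow> n \<ge> M \<Longrightarrow> dist (a m) (a n) < e / 2"
    using metric_CauchyD[OF convergent_Cauchy[OF a], of "e / 2"] by auto
  have near: "dist (p M) (p m) < e / 2" if "m \<ge> M" for m
  proof -
    have "dist (p M) (p m) \<le> a M - a m"
      using bound[of M "m - M"] that by simp
    also have "\<dots> < e / 2"
      using M[OF order_refl that] unfolding dist_real_def by linarith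
    finally show ?thesis .
  qed
  have "dist (p m) (p n) < e" if "m \<ge> M" "n \<ge> M" for m n
    using near[OF that(1)] near[OF that(2)] by (rule dist_triangle_half_r)
  then show "\<exists>M. \<forall>m\<ge>M. \<forall>n\<ge>M. dist (p m) (p n) < e" by blast
qed

text \<open>If the absolute values tend to \<open>\<tau> > 0\<close>, the sequence eventually avoids
  the interval from \<open>-\<tau>/2\<close> to \<open>\<tau>/2\<close>, and steps shorter than
  \<open>\<tau>/2\<close> cannot cross it. The sign is then eventually constant.\<close>

lemma convergent_of_abs_convergent:
  fixes t :: "nat \<Rightarrow> real"
  assumes conv: "convergent (\<lambda>n. \<bar>t n\<bar>)" and step: "(\<lambda>n. t n - t (Suc n)) \<longlonglongrightarrow> 0"
  shows "convergent t"
proof -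
  obtain \<tau> where \<tau>: "(\<lambda>n. \<bar>t n\<bar>) \<longlonglongrightarrow> \<tau>"
    using conv by (auto simp: convergent_def)
  then have "\<tau> \<ge> 0"
    by (rule LIMSEQ_le_const) simp
  show ?thesis
  proof (cases "\<tau> = 0")
    case True
    then show ?thesis
      using \<tau> tendsto_rabs_zero_cancel by (auto simp: convergent_def)
  next
    case False
    with \<open>\<tau> \<ge> 0\<close> have "\<tau> > 0" by simp
    then have "\<forall>\<^sub>F n in sequentially. \<tau> / 2 < \<bar>t n\<bar>"
      by (intro order_tendstoD(1)[OF \<tau>]) simp
    moreover have "\<forall>\<^sub>F n in sequentially. dist (t n - t (Suc n)) 0 < \<tau> / 2"
      using step \<open>\<tau> > 0\<close> by (intro tendstoD) auto
    ultimately have "\<forall>\<^sub>F n in sequentially. \<tau> / 2 < \<bar>t n\<bar> \<and> \<bar>t n - t (Suc n)\<bar> < \<tau> / 2"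
      by eventually_elim simp
    then obtain K where big: "\<And>n. n \<ge> K \<Longrightarrow> \<tau> / 2 < \<bar>t n\<bar>"
      and small: "\<And>n. n \<ge> K \<Longrightarrow> \<bar>t n - t (Suc n)\<bar> < \<tau> / 2"
      by (auto simp: eventually_sequentially)
    have "sgn (t n) = sgn (t K)" if "n \<ge> K" for n
      using that
    proof (induction n rule: dec_induct)
      case (step n)
      have "sgn (t (Suc n)) = sgn (t n)"
        using big[of n] small[of n] \<open>\<tau> > 0\<close> step.hyps by (auto simp: sgn_if abs_if split: if_splits)
      with step.IH show ?case by simp
    qed simp
    then have "t n = sgn (t K) * \<bar>t n\<bar>" if "n \<ge> K" for n
      using that by (metis sgn_mult_abs)
    then have "\<forall>\<^sub>F n in sequentially. sgn (t K) * \<bar>t n\<bar> = t n"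
      unfolding eventually_sequentially by metis
    moreover have "(\<lambda>n. sgn (t K) * \<bar>t n\<bar>) \<longlonglongrightarrow> sgn (t K) * \<tau>"
      by (intro tendsto_mult_left \<tau>)
    ultimately have "t \<longlonglongrightarrow> sgn (t K) * \<tau>"
      by (rule Lim_transform_eventually[rotated])
    then show ?thesis by (auto simp: convergent_def)
  qed
qed

lemma convergent_of_eventually_decreasing:
  fixes x :: "nat \<Rightarrow> real"
  assumes dec: "\<forall>\<^sub>F n in sequentially. x (Suc n) \<le> x n" and nonneg: "\<And>n. 0 \<le> x n"
  shows "convergent x"
proof -
  obtain K where "\<And>n. n \<ge> K \<Longrightarrow> x (Suc n) \<le> x n"
    using dec by (auto simp: eventually_sequentially)
  then have "decseq (\<lambda>n. x (n + K))"
    by (simp add: decseq_Suc_iff)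
  then have "convergent (\<lambda>n. x (n + K))"
    using decseq_convergent[of "\<lambda>n. x (n + K)" 0] nonneg by (metis convergentI)
  then show ?thesis
    by (simp add: convergent_ignore_initial_segment)
qed

lemma tendsto_0_of_power2_le:
  fixes a D :: "nat \<Rightarrow> real"
  assumes "c > 0" and le: "\<forall>\<^sub>F n in sequentially. c * (a n)\<^sup>2 \<le> D n" and D: "D \<longlonglongrightarrow> 0"
  shows "a \<longlonglongrightarrow> 0"
proof -
  have "(\<lambda>n. (a n)\<^sup>2) \<longlonglongrightarrow> 0"
  proof (rule Lim_null_comparison)
    show "\<forall>\<^sub>F n in sequentially. norm ((a n)\<^sup>2) \<le> D n / c"
      using le by eventually_elim (use \<open>c > 0\<close> in \<open>simp add: field_simps\<close>)
    show "(\<lambda>n. D n / c) \<longlonglongrightarrow> 0"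
      using tendsto_divide[OF D tendsto_const[of c]] \<open>c > 0\<close> by simp
  qed
  then have "(\<lambda>n. \<bar>a n\<bar>) \<longlonglongrightarrow> 0"
    using tendsto_real_sqrt[of "\<lambda>n. (a n)\<^sup>2" 0] by simp
  then show ?thesis
    by (rule tendsto_rabs_zero_cancel)
qed

text \<open>The Fejer inequalities for the points of a disc in the hyperplane force the component of the
  sequence parallel to the hyperplane to have finite length. The normal component converges in
  absolute value, and vanishing steps prevent it from changing sign.\<close>

lemma fejer_monotone_hyperplane_convergent:
  fixes u :: "nat \<Rightarrow> 'a::{real_inner, complete_space}"
  assumes P: "hyperplane P" "c \<in> P" and "\<rho> > 0"
    and fejer: "\<And>z n. z \<in> P \<inter> ball c \<rho> \<Longrightarrow> norm (u (Suc n) - z) \<le> norm (u n - z)"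
    and step: "(\<lambda>n. u n - u (Suc n)) \<longlonglongrightarrow> 0"
  shows "convergent u"
proof -
  obtain e where e: "norm e = 1" and P_mem: "\<And>y. y \<bullet> e = 0 \<Longrightarrow> c + y \<in> P"
    using hyperplane_normal_form[OF P] by blast
  have ee: "e \<bullet> e = 1"
    using e by (simp add: dot_square_norm)
  define x where "x n = u n - c" for n
  define t where "t n = x n \<bullet> e" for n
  define p where "p n = x n - t n *\<^sub>R e" for n
  have p_e: "p n \<bullet> e = 0" for n
    by (simp add: p_def t_def inner_diff_left ee)
  have x_decomp: "x n = p n + t n *\<^sub>R e" for n
    by (simp add: p_def)
  have "norm (x (Suc n)) \<le> norm (x n)" for n
    using fejer[of c n] P(2) \<open>\<rho> > 0\<close> by (simp add: x_def)
  then have "convergent (\<lambda>n. norm (x n))"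
    by (intro convergent_of_eventually_decreasing) auto
  then obtain L where L: "(\<lambda>n. norm (x n)) \<longlonglongrightarrow> L"
    by (auto simp: convergent_def)
  have "convergent p"
  proof (rule convergent_of_telescoping_bound)
    fix n
    define d where "d = p n - p (Suc n)"
    define s where "s = sgn d"
    show "norm (p n - p (Suc n)) \<le> (norm (x n))\<^sup>2 / \<rho> - (norm (x (Suc n)))\<^sup>2 / \<rho>"
    proof (cases "d = 0")
      case True
      have "(norm (x (Suc n)))\<^sup>2 \<le> (norm (x n))\<^sup>2"
        using \<open>norm (x (Suc n)) \<le> norm (x n)\<close> by (simp add: power_mono)
      then show ?thesis
        using True \<open>\<rho> > 0\<close> by (simp add: d_def divide_right_mono)
    next
      case False
      have s_e: "s \<bullet> e = 0"
        by (simp add: s_def d_def sgn_div_norm inner_diff_left p_e)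
      then have x_s: "x k \<bullet> s = p k \<bullet> s" for k
        by (simp add: x_decomp inner_add_left inner_commute[of e])
      have d_s: "d \<bullet> s = norm d"
        using False by (simp add: s_def sgn_div_norm dot_square_norm power2_eq_square)
      \<comment> \<open>The test point lies in the direction from which the parallel component
        retreats, so Fejer monotonicity charges the length of that retreat to the decrease of the
        squared norm. The factor \<open>1/2\<close> keeps the point inside the open ball and cancels
        the 2 of the expanded square.\<close>
      have "c + (\<rho> / 2) *\<^sub>R s \<in> P \<inter> ball c \<rho>"
        using P_mem[of "(\<rho> / 2) *\<^sub>R s"] s_e \<open>\<rho> > 0\<close> False
        by (simp add: dist_norm s_def norm_sgn)
      from fejer[OF this, of n]
      have "(norm (x (Suc n) - (\<rho> / 2) *\<^sub>R s))\<^sup>2 \<le> (norm (x n - (\<rho> / 2) *\<^sub>R s))\<^sup>2"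
        by (intro power_mono) (simp_all add: x_def algebra_simps)
      then have "\<rho> * (x n \<bullet> s - x (Suc n) \<bullet> s) \<le> (norm (x n))\<^sup>2 - (norm (x (Suc n)))\<^sup>2"
        by (simp add: dot_square_norm[symmetric] inner_diff_left inner_diff_right inner_commute
            algebra_simps)
      then have "\<rho> * norm d \<le> (norm (x n))\<^sup>2 - (norm (x (Suc n)))\<^sup>2"
        using d_s by (simp add: x_s d_def inner_diff_left)
      then show ?thesis
        using \<open>\<rho> > 0\<close> by (simp add: d_def field_simps)
    qed
    show "convergent (\<lambda>n. (norm (x n))\<^sup>2 / \<rho>)"
      by (rule convergentI) (use \<open>\<rho> > 0\<close> in \<open>auto intro!: tendsto_intros L\<close>)
  qed
  then obtain q where q: "p \<longlonglongrightarrow> q"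
    by (auto simp: convergent_def)
  \<comment> \<open>Pythagoras: with \<open>norm (x n)\<close> and \<open>p n\<close> convergent,
    only the sign of the normal component remains open.\<close>
  have t_abs: "\<bar>t n\<bar> = sqrt ((norm (x n))\<^sup>2 - (norm (p n))\<^sup>2)" for n
  proof -
    have "(t n)\<^sup>2 = (norm (x n))\<^sup>2 - (norm (p n))\<^sup>2"
      using p_e[of n] unfolding x_decomp power2_norm_eq_inner
      by (simp add: inner_add_left inner_add_right inner_commute[of e "p n"] ee power2_eq_square)
    then show ?thesis by (metis real_sqrt_abs)
  qed
  have "(\<lambda>n. \<bar>t n\<bar>) \<longlonglongrightarrow> sqrt (L\<^sup>2 - (norm q)\<^sup>2)"
    unfolding t_abs by (intro tendsto_intros L q)
  then have "convergent (\<lambda>n. \<bar>t n\<bar>)"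
    by (rule convergentI)
  moreover have "(\<lambda>n. t n - t (Suc n)) \<longlonglongrightarrow> 0"
    using tendsto_inner[OF step tendsto_const[of e]]
    by (simp add: t_def x_def inner_diff_left)
  ultimately have "convergent t"
    by (rule convergent_of_abs_convergent)
  then obtain \<tau> where "t \<longlonglongrightarrow> \<tau>"
    by (auto simp: convergent_def)
  then have "(\<lambda>n. c + (p n + t n *\<^sub>R e)) \<longlonglongrightarrow> c + (q + \<tau> *\<^sub>R e)"
    using q by (intro tendsto_intros)
  then show ?thesis
    unfolding x_decomp[symmetric] by (auto simp: x_def convergent_def)
qed

section \<open>Subgradient projections\<close>

text \<open>A zero subgradient would make \<open>x\<close> a global minimizer, although
  \<open>v\<close> has a smaller value.\<close>

lemma subgradient_nonzero:
  assumes "g \<in> subdifferential \<theta> x" "\<theta> v \<le> 0" "0 < \<theta> x"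
  shows "g \<noteq> 0"
  using assms by (auto simp: subdifferential_def dest: spec[of _ v])

text \<open>One formula covers every case: the coefficient vanishes when
  \<open>\<theta> x = 0\<close>, and also when \<open>g x = 0\<close>, because division by zero
  yields zero. Both branches of the recursion thus become one.\<close>

lemma relaxed_subgradient_projection_eq:
  assumes "0 \<le> \<theta> x"
  shows "relaxed_subgradient_projection l \<theta> g x = x - (l * (\<theta> x / (norm (g x))\<^sup>2)) *\<^sub>R g x"
  using assms by (auto simp: relaxed_subgradient_projection_def subgradient_projection_def)

lemma norm_relaxed_subgradient_projection_residual:
  assumes "0 \<le> \<theta> x" "0 \<le> l"
  shows "norm (x - relaxed_subgradient_projection l \<theta> g x) = l * (\<theta> x / norm (g x))"
  using assms by (simp add: relaxed_subgradient_projection_eq power2_eq_square)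

text \<open>The subgradient inequality at \<open>v\<close> gives
  \<open>\<theta> x \<le> g x \<bullet> (x - v)\<close>. Expanding the square then leaves the factor
  \<open>l\<^sup>2 - 2 * l\<close>, that is \<open>- l * (2 - l)\<close>. For \<open>g x = 0\<close>
  there is no movement and the quotient is zero.\<close>

lemma relaxed_subgradient_projection_step:
  assumes sub: "g x \<in> subdifferential \<theta> x" and nn: "0 \<le> \<theta> x" and v: "\<theta> v \<le> 0" and l: "0 \<le> l"
  shows "(norm (relaxed_subgradient_projection l \<theta> g x - v))\<^sup>2
    \<le> (norm (x - v))\<^sup>2 - l * (2 - l) * (\<theta> x / norm (g x))\<^sup>2"
proof (cases "g x = 0")
  case False
  define c where "c = l * (\<theta> x / (norm (g x))\<^sup>2)"
  have "g x \<bullet> (v - x) + \<theta> x \<le> \<theta> v"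
    using sub by (simp add: subdifferential_def)
  then have ge: "\<theta> x \<le> g x \<bullet> (x - v)"
    using v by (simp add: inner_diff_right)
  have "c \<ge> 0"
    using nn l by (simp add: c_def)
  have "relaxed_subgradient_projection l \<theta> g x - v = (x - v) - c *\<^sub>R g x"
    using nn by (simp add: relaxed_subgradient_projection_eq c_def)
  then have "(norm (relaxed_subgradient_projection l \<theta> g x - v))\<^sup>2
      = (norm (x - v))\<^sup>2 - 2 * (c * (g x \<bullet> (x - v))) + c\<^sup>2 * (norm (g x))\<^sup>2"
    by (simp only: dot_square_norm[symmetric])
      (simp add: inner_diff_left inner_diff_right inner_commute power2_eq_square algebra_simps)
  also have "\<dots> \<le> (norm (x - v))\<^sup>2 - 2 * (c * \<theta> x) + c\<^sup>2 * (norm (g x))\<^sup>2"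
    using mult_left_mono[OF ge \<open>c \<ge> 0\<close>] by simp
  also have "\<dots> = (norm (x - v))\<^sup>2 - l * (2 - l) * (\<theta> x / norm (g x))\<^sup>2"
    using False by (simp add: c_def power2_eq_square field_simps)
  finally show ?thesis .
qed (use nn in \<open>simp add: relaxed_subgradient_projection_eq\<close>)

lemma Fix_relaxed_subgradient_projection:
  assumes sub: "\<And>x. g x \<in> subdifferential \<theta> x" and nn: "\<And>x. 0 \<le> \<theta> x"
    and v: "\<theta> v \<le> 0" and l: "0 < l"
  shows "Fix (relaxed_subgradient_projection l \<theta> g) = lev0 \<theta>"
proof -
  have "relaxed_subgradient_projection l \<theta> g x = x \<longleftrightarrow> \<theta> x \<le> 0" for x
  proof (cases "\<theta> x = 0")
    case False
    then have "0 < \<theta> x" using nn[of x] by simp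
    then show ?thesis
      using subgradient_nonzero[OF sub v] l by (simp add: relaxed_subgradient_projection_eq)
  qed (simp add: relaxed_subgradient_projection_eq)
  then show ?thesis
    by (simp add: Fix_def lev0_def)
qed

text \<open>Lets all mappings share one attraction constant, the infimum of the
  \<open>\<eta> n\<close>.\<close>

lemma attracting_qne_antimono:
  assumes "attracting_qne \<eta> T" "0 < e" "e \<le> \<eta>"
  shows "attracting_qne e T"
  unfolding attracting_qne_def
proof (intro conjI allI ballI)
  fix x v assume "v \<in> Fix T"
  then have "\<eta> * (norm (x - T x))\<^sup>2 \<le> (norm (x - v))\<^sup>2 - (norm (T x - v))\<^sup>2"
    using assms(1) by (simp add: attracting_qne_def)
  then show "e * (norm (x - T x))\<^sup>2 \<le> (norm (x - v))\<^sup>2 - (norm (T x - v))\<^sup>2"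
    using mult_right_mono[OF assms(3), of "(norm (x - T x))\<^sup>2"] by simp
qed (use assms in \<open>auto simp: attracting_qne_def\<close>)

section \<open>The iteration and its decrement\<close>

locale attracting_subgradient_iteration =
  fixes \<theta> :: "nat \<Rightarrow> 'a::{real_inner, complete_space} \<Rightarrow> real"
    and g :: "nat \<Rightarrow> 'a \<Rightarrow> 'a"
    and T :: "nat \<Rightarrow> 'a \<Rightarrow> 'a"
    and \<eta> l :: "nat \<Rightarrow> real"
    and u :: "nat \<Rightarrow> 'a"
  assumes nonneg: "\<And>n x. 0 \<le> \<theta> n x"
    and subgrad: "\<And>n x. g n x \<in> subdifferential (\<theta> n) x"
    and attr: "\<And>n. attracting_qne (\<eta> n) (T n)"
    and l: "\<And>n. l n \<in> {0<..<2}"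
    and u_Suc: "\<And>n. u (Suc n) = T n (relaxed_subgradient_projection (l n) (\<theta> n) (g n) (u n))"
begin

abbreviation y :: "nat \<Rightarrow> 'a" where
  "y n \<equiv> relaxed_subgradient_projection (l n) (\<theta> n) (g n) (u n)"

lemma eta_pos: "0 < \<eta> n"
  using attr by (simp add: attracting_qne_def)

text \<open>Adds the attraction estimate for \<open>T n\<close> at \<open>y n\<close> to the
  projection estimate at \<open>u n\<close>. The constant \<open>e\<close> is kept free so that it
  can be \<open>\<eta> n\<close> itself or one uniform in \<open>n\<close>.\<close>

lemma decrement:
  assumes e: "attracting_qne e (T n)" and v: "v \<in> Omega_at T \<theta> n"
  shows "e * (norm (y n - T n (y n)))\<^sup>2 + l n * (2 - l n) * (\<theta> n (u n) / norm (g n (u n)))\<^sup>2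
    \<le> (norm (u n - v))\<^sup>2 - (norm (u (Suc n) - v))\<^sup>2"
proof -
  have "e * (norm (y n - T n (y n)))\<^sup>2 \<le> (norm (y n - v))\<^sup>2 - (norm (T n (y n) - v))\<^sup>2"
    using e v by (simp add: attracting_qne_def Omega_at_def)
  moreover have "(norm (y n - v))\<^sup>2
      \<le> (norm (u n - v))\<^sup>2 - l n * (2 - l n) * (\<theta> n (u n) / norm (g n (u n)))\<^sup>2"
    using v l[of n]
    by (intro relaxed_subgradient_projection_step subgrad nonneg) (simp_all add: Omega_at_def lev0_def)
  ultimately show ?thesis
    by (simp add: u_Suc)
qed

lemma fejer:
  assumes "v \<in> Omega_at T \<theta> n"
  shows "norm (u (Suc n) - v) \<le> norm (u n - v)"
proof -
  have "0 \<le> \<eta> n * (norm (y n - T n (y n)))\<^sup>2 + l n * (2 - l n) * (\<theta> n (u n) / norm (g n (u n)))\<^sup>2"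
    using eta_pos[of n] l[of n] by (intro add_nonneg_nonneg mult_nonneg_nonneg) auto
  also have "\<dots> \<le> (norm (u n - v))\<^sup>2 - (norm (u (Suc n) - v))\<^sup>2"
    by (rule decrement[OF attr assms])
  finally have "(norm (u (Suc n) - v))\<^sup>2 \<le> (norm (u n - v))\<^sup>2" by simp
  then show ?thesis
    by (rule power2_le_imp_le) simp
qed

lemma infdist_decreasing:
  assumes "A \<subseteq> Omega_at T \<theta> n"
  shows "infdist (u (Suc n)) A \<le> infdist (u n) A"
proof (rule infdist_mono_dist)
  fix v assume "v \<in> A"
  then show "dist (u (Suc n)) v \<le> dist (u n) v"
    unfolding dist_norm using assms by (intro fejer) blast
qed

section \<open>Limits obtained from a point common to almost all of the sets\<close>

context
  fixes N :: "nat set" and v :: 'a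
  assumes N: "finite (- N)" and v: "v \<in> Omega T \<theta> N"
begin

lemma v_mem: "n \<in> N \<Longrightarrow> v \<in> Omega_at T \<theta> n"
  using v by (auto simp: Omega_def)

lemma lev0_nonempty: "n \<in> N \<Longrightarrow> lev0 (\<theta> n) \<noteq> {}"
  using v_mem by (auto simp: Omega_at_def)

lemma Fix_relaxed:
  assumes "n \<in> N"
  shows "Fix (relaxed_subgradient_projection (l n) (\<theta> n) (g n)) = lev0 (\<theta> n)"
  using v_mem[OF assms] l[of n]
  by (intro Fix_relaxed_subgradient_projection[where v = v] subgrad nonneg)
    (auto simp: Omega_at_def lev0_def)

lemma convergent_dist: "convergent (\<lambda>n. norm (u n - v))"
  using eventually_mem_cofinite[OF N]
  by (intro convergent_of_eventually_decreasing) (auto elim!: eventually_mono intro: fejer v_mem)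

lemma decrement_tendsto_0: "(\<lambda>n. (norm (u n - v))\<^sup>2 - (norm (u (Suc n) - v))\<^sup>2) \<longlonglongrightarrow> 0"
proof -
  obtain a where a: "(\<lambda>n. norm (u n - v)) \<longlonglongrightarrow> a"
    using convergent_dist by (auto simp: convergent_def)
  from tendsto_diff[OF tendsto_power[OF a] tendsto_power[OF LIMSEQ_Suc[OF a]], of 2 2]
  show ?thesis by simp
qed

lemma bounded_u: "bounded (range u)"
proof -
  have "bounded (range (\<lambda>n. norm (u n - v)))"
    using convergent_dist convergent_imp_bounded by (auto simp: convergent_def)
  then obtain B where "\<And>n. norm (u n - v) \<le> B"
    by (auto simp: bounded_iff)
  then show ?thesis
    by (intro bounded_subset[OF bounded_cball[of v B]]) (auto simp: dist_norm norm_minus_commute)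
qed

lemma weak_cluster_points_nonempty: "weak_cluster_points u \<noteq> {}"
  using bounded_imp_weakly_convergent_subseq[OF bounded_u] by (auto simp: weak_cluster_points_def)

lemma T_residual_tendsto_0:
  assumes "e > 0" and e: "\<And>n. attracting_qne e (T n)"
  shows "(\<lambda>n. y n - T n (y n)) \<longlonglongrightarrow> 0"
proof -
  have "(\<lambda>n. norm (y n - T n (y n))) \<longlonglongrightarrow> 0"
  proof (rule tendsto_0_of_power2_le[OF \<open>e > 0\<close> _ decrement_tendsto_0])
    show "\<forall>\<^sub>F n in sequentially. e * (norm (y n - T n (y n)))\<^sup>2
        \<le> (norm (u n - v))\<^sup>2 - (norm (u (Suc n) - v))\<^sup>2"
      using eventually_mem_cofinite[OF N]
    proof eventually_elim
      case (elim n)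
      have "0 \<le> l n * (2 - l n) * (\<theta> n (u n) / norm (g n (u n)))\<^sup>2"
        using l[of n] by simp
      then show ?case
        using decrement[OF e v_mem[OF elim]] by argo
    qed
  qed
  then show ?thesis by (rule tendsto_norm_zero_cancel)
qed

lemma T_residual_tendsto_0_of_attraction_bounded:
  assumes "attraction_bounded \<eta>"
  shows "(\<lambda>n. y n - T n (y n)) \<longlonglongrightarrow> 0"
proof (rule T_residual_tendsto_0)
  show "0 < (INF n. \<eta> n)"
    using assms by (simp add: attraction_bounded_def)
  show "attracting_qne (INF n. \<eta> n) (T n)" for n
    by (rule attracting_qne_antimono[OF attr])
      (use assms in \<open>simp_all add: attraction_bounded_def cINF_lower\<close>)
qed

context
  assumes relax: "relaxation_bounded l"
begin

lemma ratio_tendsto_0: "(\<lambda>n. \<theta> n (u n) / norm (g n (u n))) \<longlonglongrightarrow> 0"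
proof -
  obtain \<epsilon> where \<epsilon>: "0 < \<epsilon>" "\<And>n. \<epsilon> \<le> l n" "\<And>n. l n \<le> 2 - \<epsilon>"
    using relax by (auto simp: relaxation_bounded_def)
  show ?thesis
  proof (rule tendsto_0_of_power2_le[OF _ _ decrement_tendsto_0])
    show "0 < \<epsilon> * \<epsilon>" using \<epsilon> by simp
    show "\<forall>\<^sub>F n in sequentially. \<epsilon> * \<epsilon> * (\<theta> n (u n) / norm (g n (u n)))\<^sup>2
        \<le> (norm (u n - v))\<^sup>2 - (norm (u (Suc n) - v))\<^sup>2"
      using eventually_mem_cofinite[OF N]
    proof eventually_elim
      case (elim n)
      \<comment> \<open>Both factors \<open>l n\<close> and \<open>2 - l n\<close> are at least
        \<open>\<epsilon>\<close>.\<close>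
      have "\<epsilon> * \<epsilon> \<le> l n * (2 - l n)"
        using \<epsilon>(1) \<epsilon>(2)[of n] \<epsilon>(3)[of n] by (intro mult_mono) auto
      then have "\<epsilon> * \<epsilon> * (\<theta> n (u n) / norm (g n (u n)))\<^sup>2
          \<le> l n * (2 - l n) * (\<theta> n (u n) / norm (g n (u n)))\<^sup>2"
        by (rule mult_right_mono) simp
      moreover have "0 \<le> \<eta> n * (norm (y n - T n (y n)))\<^sup>2"
        using eta_pos[of n] by simp
      ultimately show ?case
        using decrement[OF attr v_mem[OF elim]] by argo
    qed
  qed
qed

lemma projection_residual_tendsto_0: "(\<lambda>n. norm (u n - y n)) \<longlonglongrightarrow> 0"
proof (rule Lim_null_comparison)
  show "\<forall>\<^sub>F n in sequentially. norm (norm (u n - y n)) \<le> 2 * (\<theta> n (u n) / norm (g n (u n)))"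
  proof (intro always_eventually allI)
    fix n
    have "l n * (\<theta> n (u n) / norm (g n (u n))) \<le> 2 * (\<theta> n (u n) / norm (g n (u n)))"
      using l[of n] nonneg[of n "u n"] by (intro mult_right_mono) auto
    then show "norm (norm (u n - y n)) \<le> 2 * (\<theta> n (u n) / norm (g n (u n)))"
      using norm_relaxed_subgradient_projection_residual[of "\<theta> n" "u n" "l n" "g n"] l[of n]
        nonneg[of n "u n"] by simp
  qed
  show "(\<lambda>n. 2 * (\<theta> n (u n) / norm (g n (u n)))) \<longlonglongrightarrow> 0"
    using tendsto_mult_left[OF ratio_tendsto_0, of 2] by simp
qed

lemma theta_tendsto_0:
  assumes "bounded (range (\<lambda>n. g n (u n)))"
  shows "(\<lambda>n. \<theta> n (u n)) \<longlonglongrightarrow> 0"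
proof -
  obtain B where B: "\<And>n. norm (g n (u n)) \<le> B"
    using assms by (auto simp: bounded_iff)
  show ?thesis
  proof (rule Lim_null_comparison)
    show "\<forall>\<^sub>F n in sequentially. norm (\<theta> n (u n)) \<le> \<theta> n (u n) / norm (g n (u n)) * B"
      using eventually_mem_cofinite[OF N]
    proof eventually_elim
      case (elim n)
      \<comment> \<open>Multiplying the ratio back by the subgradient norm recovers
        \<open>\<theta> n (u n)\<close> only if the quotient is not a division of a positive number
        by zero; a point of the level set excludes that.\<close>
      have "\<theta> n (u n) = 0 \<or> g n (u n) \<noteq> 0"
        using subgradient_nonzero[OF subgrad[of n "u n"], of v] v_mem[OF elim] nonneg[of n "u n"]
        by (force simp: Omega_at_def lev0_def)
      then have "\<theta> n (u n) = \<theta> n (u n) / norm (g n (u n)) * norm (g n (u n))"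
        by auto
      also have "\<dots> \<le> \<theta> n (u n) / norm (g n (u n)) * B"
        using B nonneg by (intro mult_left_mono) auto
      finally show ?case using nonneg by simp
    qed
    show "(\<lambda>n. \<theta> n (u n) / norm (g n (u n)) * B) \<longlonglongrightarrow> 0"
      using tendsto_mult_right[OF ratio_tendsto_0, of B] by simp
  qed
qed

text \<open>Condition (L) measures distances to fixed point sets; for \<open>n\<close> in
  \<open>N\<close>, hence eventually, these are the level sets.\<close>

lemma infdist_lev0_tendsto_0:
  assumes "condition_L N (\<lambda>n. relaxed_subgradient_projection (l n) (\<theta> n) (g n))"
  shows "(\<lambda>n. infdist (u n) (lev0 (\<theta> n))) \<longlonglongrightarrow> 0"
  by (rule Lim_transform_eventually[OF condition_L_infdist_tendsto_0[OF assms N projection_residual_tendsto_0]])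
    (use eventually_mem_cofinite[OF N] in eventually_elim, simp add: Fix_relaxed)

text \<open>The residual of \<open>T n\<close> vanishes at \<open>y n\<close>, so (L) is applied
  there; the triangle inequality carries the result back to \<open>u n\<close>.\<close>

lemma infdist_Fix_tendsto_0:
  assumes L: "condition_L UNIV T" and A: "attraction_bounded \<eta>"
  shows "(\<lambda>n. infdist (u n) (Fix (T n))) \<longlonglongrightarrow> 0"
proof (rule tendsto_sandwich[where f = "\<lambda>_. 0"])
  have "(\<lambda>n. infdist (y n) (Fix (T n))) \<longlonglongrightarrow> 0"
    using T_residual_tendsto_0_of_attraction_bounded[OF A]
    by (intro condition_L_infdist_tendsto_0[OF L]) (simp_all add: tendsto_norm_zero)
  from tendsto_add[OF this projection_residual_tendsto_0]
  show "(\<lambda>n. infdist (y n) (Fix (T n)) + norm (u n - y n)) \<longlonglongrightarrow> 0" by simp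
  show "\<forall>\<^sub>F n in sequentially. infdist (u n) (Fix (T n))
      \<le> infdist (y n) (Fix (T n)) + norm (u n - y n)"
    using infdist_triangle[of "u _" _ "y _"]
    by (intro always_eventually allI) (simp add: dist_norm)
qed (auto simp: infdist_nonneg)

text \<open>Demiclosedness is applied along \<open>y\<close>, where the residuals of
  \<open>S\<close> vanish. Since \<open>y n - u n\<close> tends to zero in norm, subsequences of
  \<open>y\<close> inherit the weak limits of those of \<open>u\<close>.\<close>

lemma weak_cluster_points_subset_Fix:
  assumes S: "common_strongly_attracting T S"
  shows "weak_cluster_points u \<subseteq> Fix S"
proof
  fix z assume "z \<in> weak_cluster_points u"
  then obtain r where r: "strict_mono r" and z: "weakly_converges (u \<circ> r) z"
    by (auto simp: weak_cluster_points_def)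
  have T_eq: "T = (\<lambda>n. S)" and demi: "demiclosed_at_0 (\<lambda>x. x - S x)"
    using S by (auto simp: common_strongly_attracting_def)
  obtain e where "e > 0" "\<And>n. attracting_qne e (T n)"
    using S by (auto simp: common_strongly_attracting_def strongly_attracting_qne_def)
  then have res: "(\<lambda>n. y n - S (y n)) \<longlonglongrightarrow> 0"
    using T_residual_tendsto_0 by (simp add: T_eq)
  have "(\<lambda>n. y n - u n) \<longlonglongrightarrow> 0"
    using projection_residual_tendsto_0 tendsto_norm_zero_iff[of "\<lambda>n. y n - u n"]
    by (simp add: norm_minus_commute)
  then have diff: "(\<lambda>k. y (r k) - u (r k)) \<longlonglongrightarrow> 0"
    using LIMSEQ_subseq_LIMSEQ[OF _ r, of "\<lambda>n. y n - u n"] by (simp add: o_def)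
  have "weakly_converges (\<lambda>k. y (r k)) z"
    unfolding weakly_converges_def
  proof (intro allI impI)
    fix f :: "'a \<Rightarrow> real" assume f: "bounded_linear f"
    have "(\<lambda>k. f (y (r k) - u (r k)) + f (u (r k))) \<longlonglongrightarrow> f 0 + f z"
      using z f bounded_linear.tendsto[OF f diff]
      by (intro tendsto_add) (auto simp: weakly_converges_def)
    then show "(\<lambda>k. f (y (r k))) \<longlonglongrightarrow> f z"
      using f by (simp add: linear_simps)
  qed
  moreover have "(\<lambda>k. y (r k) - S (y (r k))) \<longlonglongrightarrow> 0"
    using LIMSEQ_subseq_LIMSEQ[OF res r] by (simp add: o_def)
  ultimately have "z - S z = 0"
    using demi by (auto simp: demiclosed_at_0_def)
  then show "z \<in> Fix S"
    by (simp add: Fix_def)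
qed

lemma step_tendsto_0:
  assumes "attraction_bounded \<eta>"
  shows "(\<lambda>n. u n - u (Suc n)) \<longlonglongrightarrow> 0"
proof -
  have "(\<lambda>n. u n - y n) \<longlonglongrightarrow> 0"
    using projection_residual_tendsto_0 by (rule tendsto_norm_zero_cancel)
  from tendsto_add[OF this T_residual_tendsto_0_of_attraction_bounded[OF assms]]
  show ?thesis by (simp add: u_Suc)
qed

lemma convergent_of_hyperplane_interior:
  assumes A: "attraction_bounded \<eta>" and P: "hyperplane P" and ri: "ri P (Omega T \<theta> N) \<noteq> {}"
  shows "convergent u"
proof -
  \<comment> \<open>The centre \<open>w\<close> from \<open>ri\<close> may lie off the hyperplane,
    so the disc is recentred at a point \<open>c\<close> of \<open>P\<close> inside the same
    ball.\<close>
  obtain w \<rho> c where c: "c \<in> ball w \<rho>" "c \<in> P" and sub: "ball w \<rho> \<inter> P \<subseteq> Omega T \<theta> N"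
    using ri by (auto simp: ri_def)
  obtain K where K: "\<And>n. n \<ge> K \<Longrightarrow> n \<in> N"
    using eventually_mem_cofinite[OF N] by (auto simp: eventually_sequentially)
  obtain \<delta> where "\<delta> > 0" and \<delta>: "ball c \<delta> \<subseteq> ball w \<rho>"
    using c(1) open_ball open_contains_ball by blast
  \<comment> \<open>The shift by \<open>K\<close> skips the exceptional indices, since the criterion
    requires the Fejer inequality at every index.\<close>
  have "convergent (\<lambda>n. u (n + K))"
  proof (rule fejer_monotone_hyperplane_convergent[OF P c(2) \<open>\<delta> > 0\<close>])
    fix z n assume "z \<in> P \<inter> ball c \<delta>"
    then have "z \<in> Omega T \<theta> N" using \<delta> sub by blast
    then have "z \<in> Omega_at T \<theta> (n + K)" using K[of "n + K"] by (simp add: Omega_def)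
    then show "norm (u (Suc n + K) - z) \<le> norm (u (n + K) - z)" using fejer by simp
  next
    show "(\<lambda>n. u (n + K) - u (Suc n + K)) \<longlonglongrightarrow> 0"
      using LIMSEQ_ignore_initial_segment[OF step_tendsto_0[OF A], of K] by simp
  qed
  then show ?thesis
    by (simp add: convergent_ignore_initial_segment)
qed

end

end

end

theorem theorem18:
  fixes \<theta> :: "nat \<Rightarrow> 'a::{real_inner, complete_space} \<Rightarrow> real"
    and g :: "nat \<Rightarrow> 'a \<Rightarrow> 'a"
    and T :: "nat \<Rightarrow> 'a \<Rightarrow> 'a"
    and \<eta> l :: "nat \<Rightarrow> real"
    and u :: "nat \<Rightarrow> 'a"
  assumes nonneg: "\<And>n x. 0 \<le> \<theta> n x"
    and convex: "\<And>n. convex_on UNIV (\<theta> n)"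
    and cont: "\<And>n. continuous_on UNIV (\<theta> n)"
    and subgrad: "\<And>n x. g n x \<in> subdifferential (\<theta> n) x"
    and eta_pos: "\<And>n. \<eta> n > 0"
    and attr: "\<And>n. attracting_qne (\<eta> n) (T n)"
    and l: "\<And>n. l n \<in> {0<..<2}"
    and u_Suc: "\<And>n. u (Suc n) =
        (if g n (u n) \<noteq> 0
         then T n (u n - (l n * (\<theta> n (u n) / (norm (g n (u n)))\<^sup>2)) *\<^sub>R g n (u n))
         else T n (u n))"
  shows
    "(\<forall>N. finite (- N) \<and> (\<forall>n\<in>N. Omega_at T \<theta> n \<noteq> {}) \<longrightarrow>
        (\<forall>n\<in>N. infdist (u (Suc n)) (Omega_at T \<theta> n) \<le> infdist (u n) (Omega_at T \<theta> n))) \<and>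
     (\<forall>N. finite (- N) \<and> Omega T \<theta> N \<noteq> {} \<longrightarrow>
        (\<forall>n\<in>N. infdist (u (Suc n)) (Omega T \<theta> N) \<le> infdist (u n) (Omega T \<theta> N)) \<and>
        (\<forall>v \<in> Omega T \<theta> N. convergent (\<lambda>n. norm (u n - v))) \<and>
        weak_cluster_points u \<noteq> {} \<and>
        (relaxation_bounded l \<longrightarrow>
           (\<lambda>n. norm (u n - relaxed_subgradient_projection (l n) (\<theta> n) (g n) (u n))) \<longlonglongrightarrow> 0 \<and>
           (\<lambda>n. \<theta> n (u n) / norm (g n (u n))) \<longlonglongrightarrow> 0) \<and>
        (relaxation_bounded l \<and> bounded (range (\<lambda>n. g n (u n))) \<longrightarrow>
           (\<lambda>n. \<theta> n (u n)) \<longlonglongrightarrow> 0) \<and>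
        (relaxation_bounded l \<and>
         condition_L N (\<lambda>n. relaxed_subgradient_projection (l n) (\<theta> n) (g n)) \<and>
         strong_cluster_points u \<noteq> {} \<longrightarrow>
           strong_cluster_points u \<subseteq> limsup_sets (\<lambda>n. lev0 (\<theta> n)) \<and>
           (\<forall>u'. strong_cluster_points u = {u'} \<and> u \<longlonglongrightarrow> u' \<longrightarrow>
              u' \<in> liminf_sets (\<lambda>n. lev0 (\<theta> n)))) \<and>
        (attraction_bounded \<eta> \<longrightarrow>
           (\<lambda>n. relaxed_subgradient_projection (l n) (\<theta> n) (g n) (u n)
                - T n (relaxed_subgradient_projection (l n) (\<theta> n) (g n) (u n))) \<longlonglongrightarrow> 0) \<and>
        (relaxation_bounded l \<and> attraction_bounded \<eta> \<and> condition_L UNIV T \<and>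
         strong_cluster_points u \<noteq> {} \<longrightarrow>
           strong_cluster_points u \<subseteq> limsup_sets (\<lambda>n. Fix (T n)) \<and>
           (\<forall>u'. strong_cluster_points u = {u'} \<and> u \<longlonglongrightarrow> u' \<longrightarrow>
              u' \<in> liminf_sets (\<lambda>n. Fix (T n)))) \<and>
        (\<forall>S. relaxation_bounded l \<and> common_strongly_attracting T S \<longrightarrow>
           weak_cluster_points u \<subseteq> Fix S) \<and>
        (\<forall>S. relaxation_bounded l \<and> common_strongly_attracting T S \<and>
           strong_cluster_points u \<noteq> {} \<longrightarrow>
             strong_cluster_points u \<subseteq> Fix S) \<and>
        (relaxation_bounded l \<and> attraction_bounded \<eta> \<and>
         (\<exists>P. hyperplane P \<and> ri P (Omega T \<theta> N) \<noteq> {}) \<longrightarrow>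
           (\<exists>u'. u \<longlonglongrightarrow> u' \<and> strong_cluster_points u = {u'})))"
proof -
  interpret attracting_subgradient_iteration \<theta> g T \<eta> l u
    by standard (use nonneg subgrad attr l u_Suc in \<open>simp_all add: relaxed_subgradient_projection_eq\<close>)
  have Fix_ne: "Fix (T n) \<noteq> {}" for n
    using attr by (simp add: attracting_qne_def)
  show ?thesis
  proof (rule conjI; intro allI impI; elim conjE)
    fix N assume "finite (- N)" "\<forall>n\<in>N. Omega_at T \<theta> n \<noteq> {}"
    show "\<forall>n\<in>N. infdist (u (Suc n)) (Omega_at T \<theta> n) \<le> infdist (u n) (Omega_at T \<theta> n)"
      by (simp add: infdist_decreasing)
  next
    fix N assume N: "finite (- N)" and "Omega T \<theta> N \<noteq> {}"
    then obtain v where v: "v \<in> Omega T \<theta> N" by blast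
    note ne = lev0_nonempty[OF N v]
    have dist: "\<forall>n\<in>N. infdist (u (Suc n)) (Omega T \<theta> N) \<le> infdist (u n) (Omega T \<theta> N)"
      by (auto simp: Omega_def intro!: infdist_decreasing)
    have conv: "\<forall>v \<in> Omega T \<theta> N. convergent (\<lambda>n. norm (u n - v))"
      using convergent_dist[OF N] by blast
    have strong_Fix: "strong_cluster_points u \<subseteq> Fix S"
      if "relaxation_bounded l" "common_strongly_attracting T S" for S
      using strong_cluster_points_subset_weak weak_cluster_points_subset_Fix[OF N v that]
      by (rule subset_trans)
    have lim: "\<exists>u'. u \<longlonglongrightarrow> u' \<and> strong_cluster_points u = {u'}"
      if "relaxation_bounded l" "attraction_bounded \<eta>" "hyperplane P" "ri P (Omega T \<theta> N) \<noteq> {}" for P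
      using convergent_of_hyperplane_interior[OF N v that] strong_cluster_points_of_convergent
      by (auto simp: convergent_def)
    show "(\<forall>n\<in>N. infdist (u (Suc n)) (Omega T \<theta> N) \<le> infdist (u n) (Omega T \<theta> N)) \<and>
        (\<forall>v \<in> Omega T \<theta> N. convergent (\<lambda>n. norm (u n - v))) \<and>
        weak_cluster_points u \<noteq> {} \<and>
        (relaxation_bounded l \<longrightarrow>
           (\<lambda>n. norm (u n - relaxed_subgradient_projection (l n) (\<theta> n) (g n) (u n))) \<longlonglongrightarrow> 0 \<and>
           (\<lambda>n. \<theta> n (u n) / norm (g n (u n))) \<longlonglongrightarrow> 0) \<and>
        (relaxation_bounded l \<and> bounded (range (\<lambda>n. g n (u n))) \<longrightarrow>
           (\<lambda>n. \<theta> n (u n)) \<longlonglongrightarrow> 0) \<and>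
        (relaxation_bounded l \<and>
         condition_L N (\<lambda>n. relaxed_subgradient_projection (l n) (\<theta> n) (g n)) \<and>
         strong_cluster_points u \<noteq> {} \<longrightarrow>
           strong_cluster_points u \<subseteq> limsup_sets (\<lambda>n. lev0 (\<theta> n)) \<and>
           (\<forall>u'. strong_cluster_points u = {u'} \<and> u \<longlonglongrightarrow> u' \<longrightarrow>
              u' \<in> liminf_sets (\<lambda>n. lev0 (\<theta> n)))) \<and>
        (attraction_bounded \<eta> \<longrightarrow>
           (\<lambda>n. relaxed_subgradient_projection (l n) (\<theta> n) (g n) (u n)
                - T n (relaxed_subgradient_projection (l n) (\<theta> n) (g n) (u n))) \<longlonglongrightarrow> 0) \<and>
        (relaxation_bounded l \<and> attraction_bounded \<eta> \<and> condition_L UNIV T \<and>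
         strong_cluster_points u \<noteq> {} \<longrightarrow>
           strong_cluster_points u \<subseteq> limsup_sets (\<lambda>n. Fix (T n)) \<and>
           (\<forall>u'. strong_cluster_points u = {u'} \<and> u \<longlonglongrightarrow> u' \<longrightarrow>
              u' \<in> liminf_sets (\<lambda>n. Fix (T n)))) \<and>
        (\<forall>S. relaxation_bounded l \<and> common_strongly_attracting T S \<longrightarrow>
           weak_cluster_points u \<subseteq> Fix S) \<and>
        (\<forall>S. relaxation_bounded l \<and> common_strongly_attracting T S \<and>
           strong_cluster_points u \<noteq> {} \<longrightarrow>
             strong_cluster_points u \<subseteq> Fix S) \<and>
        (relaxation_bounded l \<and> attraction_bounded \<eta> \<and>
         (\<exists>P. hyperplane P \<and> ri P (Omega T \<theta> N) \<noteq> {}) \<longrightarrow>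
           (\<exists>u'. u \<longlonglongrightarrow> u' \<and> strong_cluster_points u = {u'}))"
      by (intro conjI impI allI dist conv weak_cluster_points_nonempty[OF N v]; (elim conjE exE)?;
          rule projection_residual_tendsto_0[OF N v] ratio_tendsto_0[OF N v] theta_tendsto_0[OF N v]
            T_residual_tendsto_0_of_attraction_bounded[OF N v]
            strong_cluster_points_subset_limsup_sets[OF ne N infdist_lev0_tendsto_0[OF N v]]
            lim_in_liminf_sets[OF ne N infdist_lev0_tendsto_0[OF N v]]
            strong_cluster_points_subset_limsup_sets[OF Fix_ne N infdist_Fix_tendsto_0[OF N v]]
            lim_in_liminf_sets[OF Fix_ne N infdist_Fix_tendsto_0[OF N v]]
            weak_cluster_points_subset_Fix[OF N v] strong_Fix lim; assumption)
  qed
qed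

end
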